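(* Let $b_n=b_n(y)=\sum_{\pi\in\mathcal{B}_n}y^{\mathrm{cap}(\pi)}$ for $n\geq 1$, with $b_0=1$, where $\mathcal{B}_n$ is the set of compositions of $n$ with all parts in $\{1,2\}$ and $\mathrm{cap}$ is the capacity statistic. Then, as polynomials in $y$, $$b_n=(1+y)b_{n-1}+(1-y)b_{n-2}-b_{n-3}+1-y,\qquad n \geq 3,$$ and $$b_n=(2+y)b_{n-1}-2yb_{n-2}-(2-y)b_{n-3}+b_{n-4},\qquad n \geq 4,$$ with $b_0=b_1=1$, $b_2=2$ and $b_3=3$.
   Context: A composition of $n$ is a finite sequence of positive integers (parts) with sum $n$. The capacity $\mathrm{cap}(\pi)$ of a composition $\pi$ is the number of water cells of its bargraph (the unit cells outside the bargraph, whose $i$-th column has height $\pi_i$, that would hold water). For $\pi=\pi_1\cdots\pi_m\in\mathcal{B}_n$ this equals the number of indices $i$ with $\pi_i=1$ such that $\pi_a=2$ for some $a<i$ and $\pi_b=2$ for some $b>i$. *)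

theory Defs
  imports "HOL-Computational_Algebra.Polynomial"
begin

definition compositions :: "nat \<Rightarrow> nat list set" where
  "compositions n = {p. (\<forall>x\<in>set p. 0 < x) \<and> sum_list p = n}"

definition compositions12 :: "nat \<Rightarrow> nat list set" where
  "compositions12 n = {p \<in> compositions n. set p \<subseteq> {1, 2}}"

text \<open>
  The pair \<open>(i, h)\<close> stands for the unit cell at height \<open>h\<close> (counted from 1) above column \<open>i\<close>
  (counted from 0). A cell outside the bargraph holds water iff there is a cell of the bargraph
  at the same height both to its left and to its right.
\<close>

definition water_cells :: "nat list \<Rightarrow> (nat \<times> nat) set" where
  "water_cells p = {(i, h). i < length p \<and> p ! i < h \<and>
     (\<exists>a<i. h \<le> p ! a) \<and> (\<exists>b. i < b \<and> b < length p \<and> h \<le> p ! b)}"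

definition capacity :: "nat list \<Rightarrow> nat" where
  "capacity p = card (water_cells p)"

abbreviation y :: "int poly" where
  "y \<equiv> [:0, 1:]"

text \<open>For \<open>n = 0\<close> the only summand is that of the empty composition.\<close>

definition b :: "nat \<Rightarrow> int poly" where
  "b n = (\<Sum>p\<in>compositions12 n. y ^ capacity p)"

lemma finite_water_cells: "finite (water_cells p)"
proof (rule finite_subset)
  show "water_cells p \<subseteq> {..<length p} \<times> {..sum_list p}"
    unfolding water_cells_def by (auto dest: order_trans[OF _ elem_le_sum_list])
qed simp

lemma finite_compositions: "finite (compositions n)"
proof (rule finite_subset)
  have "length p \<le> sum_list p" if "\<forall>x\<in>set p. 0 < x" for p :: "nat list"
    using that by (induction p) auto
  then show "compositions n \<subseteq> {p. set p \<subseteq> {..n} \<and> length p \<le> n}"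
    unfolding compositions_def by (auto intro: member_le_sum_list)
qed (simp add: finite_lists_length_le)

lemma finite_compositions12: "finite (compositions12 n)"
  unfolding compositions12_def using finite_compositions by simp

end

theory Submission
  imports Defs
begin

text \<open>
  The recurrences come from reading a composition from the left and removing one part at a time.
  A leading \<open>1\<close> supports no water, so it can be deleted without changing the capacity. A leading
  \<open>2\<close> is a left wall of maximal height: behind it, another \<open>2\<close> can be deleted freely, while a
  \<open>1\<close> carries exactly one water cell if some \<open>2\<close> follows, and none otherwise. For each sum,
  the rest of the composition avoids \<open>2\<close> in exactly one case, namely \<open>1 \<dots> 1\<close>.

  Hence, with \<open>c n\<close> the weight sum of the compositions of \<open>n\<close> placed behind a wall of height \<open>2\<close>,
  \<open>b n = b (n - 1) + c (n - 2)\<close> and \<open>c n = y * c (n - 1) + c (n - 2) + (1 - y)\<close>,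
  where \<open>1 - y\<close> corrects the weight of that single composition. Substituting
  \<open>c (n - 2) = b n - b (n - 1)\<close> into the second equation gives the inhomogeneous recurrence for
  \<open>b\<close>, and subtracting two consecutive instances of it removes the constant \<open>1 - y\<close> and gives
  the homogeneous one.
\<close>

section \<open>Water cells after deleting a column\<close>

lemma water_cellsI:
  assumes "i < length p" "p ! i < h" "a < i" "h \<le> p ! a" "i < d" "d < length p" "h \<le> p ! d"
  shows "(i, h) \<in> water_cells p"
  using assms by (auto simp: water_cells_def)

text \<open>
  The first column is never wet, and it is a useful left wall only up to its own height; if the
  second column is at least as high, that one already serves at all those heights.
\<close>

lemma water_cells_drop_lower_first:
  assumes "x \<le> m"
  shows "water_cells (x # m # p) = map_prod Suc id ` water_cells (m # p)"
proof (intro set_eqI iffI)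
  fix c assume "c \<in> water_cells (x # m # p)"
  then obtain i h a d where c: "c = (i, h)" and i: "i < length (x # m # p)" "(x # m # p) ! i < h"
    and a: "a < i" "h \<le> (x # m # p) ! a" and d: "i < d" "d < length (x # m # p)" "h \<le> (x # m # p) ! d"
    by (auto simp: water_cells_def)
  obtain j where j: "i = Suc j" using a by (cases i) auto
  obtain e where e: "d = Suc e" using d by (cases d) auto
  have "j \<noteq> 0"
    using a i assms j by (cases j) auto
  then have "\<exists>a'<j. h \<le> (m # p) ! a'"
    using a assms j by (cases a) auto
  then have "(j, h) \<in> water_cells (m # p)"
    using i d j e by (auto simp: water_cells_def)
  then show "c \<in> map_prod Suc id ` water_cells (m # p)"
    using c j by force
next
  fix c assume "c \<in> map_prod Suc id ` water_cells (m # p)"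
  then obtain i h a d where "c = (Suc i, h)" "i < length (m # p)" "(m # p) ! i < h"
    and "a < i" "h \<le> (m # p) ! a" "i < d" "d < length (m # p)" "h \<le> (m # p) ! d"
    by (auto simp: water_cells_def)
  then show "c \<in> water_cells (x # m # p)"
    using water_cellsI[of "Suc i" "x # m # p" h "Suc a" "Suc d"] by simp
qed

text \<open>
  A second column that is not higher than the first adds nothing to the walls of later columns.
  So deleting it loses only the water standing on it, which reaches up to the lower of the first
  column and the highest later one.
\<close>

lemma water_cells_drop_lower_second:
  assumes "x \<le> m"
  shows "water_cells (m # x # p) =
    map_prod Suc id ` water_cells (m # p) \<union> {1} \<times> {h. x < h \<and> h \<le> m \<and> (\<exists>z\<in>set p. h \<le> z)}"
    (is "_ = ?R")
proof (intro set_eqI iffI)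
  fix c assume "c \<in> water_cells (m # x # p)"
  then obtain i h a d where c: "c = (i, h)" and i: "i < length (m # x # p)" "(m # x # p) ! i < h"
    and a: "a < i" "h \<le> (m # x # p) ! a" and d: "i < d" "d < length (m # x # p)" "h \<le> (m # x # p) ! d"
    by (auto simp: water_cells_def)
  obtain j where j: "i = Suc j" using a by (cases i) auto
  obtain e where e: "d = Suc (Suc e)" using d j by (cases d; cases "d - 1") auto
  show "c \<in> ?R"
  proof (cases j)
    case 0
    then show ?thesis using c i a d j e by auto
  next
    case (Suc k)
    have "\<exists>a'<j. h \<le> (m # p) ! a'"
    proof (cases "a \<le> 1")
      case True
      then have "h \<le> m" using a assms by (cases a) auto
      then show ?thesis using Suc by auto
    next
      case False
      then show ?thesis using a j by (intro exI[of _ "a - 1"]) (auto simp: nth_Cons split: nat.splits)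
    qed
    then have "(j, h) \<in> water_cells (m # p)"
      using i d j e Suc by (auto simp: water_cells_def intro!: exI[of _ "Suc e"])
    then show ?thesis using c j by force
  qed
next
  fix c assume "c \<in> ?R"
  then show "c \<in> water_cells (m # x # p)"
  proof
    assume "c \<in> map_prod Suc id ` water_cells (m # p)"
    then obtain i h a d where *: "c = (Suc i, h)" "i < length (m # p)" "(m # p) ! i < h"
      "a < i" "h \<le> (m # p) ! a" "i < d" "d < length (m # p)" "h \<le> (m # p) ! d"
      by (auto simp: water_cells_def)
    \<comment> \<open>All columns except the first move one place to the right.\<close>
    have "\<exists>a'<Suc i. h \<le> (m # x # p) ! a'"
      using * by (intro exI[of _ "if a = 0 then 0 else Suc a"]) (auto simp: nth_Cons')
    then show ?thesis
      using * water_cellsI[of "Suc i" "m # x # p" h _ "Suc d"] by (auto simp: nth_Cons')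
  next
    assume "c \<in> {1} \<times> {h. x < h \<and> h \<le> m \<and> (\<exists>z\<in>set p. h \<le> z)}"
    then obtain h e where "c = (1, h)" "x < h" "h \<le> m" "e < length p" "h \<le> p ! e"
      by (auto simp: in_set_conv_nth)
    then show ?thesis
      using water_cellsI[of 1 "m # x # p" h 0 "Suc (Suc e)"] by simp
  qed
qed

lemma card_shifted_water_cells: "card (map_prod Suc id ` water_cells p) = capacity p"
  unfolding capacity_def by (rule card_image) (auto simp: inj_on_def)

section \<open>Capacity of words over 1 and 2\<close>

lemma capacity_Nil: "capacity [] = 0"
  and capacity_singleton: "capacity [x] = 0"
  by (simp_all add: capacity_def water_cells_def)

lemma capacity_1_Cons:
  assumes "set p \<subseteq> {1, 2}"
  shows "capacity (1 # p) = capacity p"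
proof (cases p)
  case Nil
  then show ?thesis by (simp add: capacity_Nil capacity_singleton)
next
  case (Cons m q)
  then have "1 \<le> m" using assms by auto
  then have "card (water_cells (1 # m # q)) = capacity (m # q)"
    by (simp only: water_cells_drop_lower_first card_shifted_water_cells)
  then show ?thesis using Cons by (simp add: capacity_def)
qed

lemma capacity_2_2: "capacity (2 # 2 # p) = capacity (2 # p)"
  unfolding capacity_def[of "2 # 2 # p"]
  by (simp only: water_cells_drop_lower_first[OF order_refl] card_shifted_water_cells)

lemma capacity_2_1:
  assumes "set p \<subseteq> {1, 2}"
  shows "capacity (2 # 1 # p) = capacity (2 # p) + (if 2 \<in> set p then 1 else 0)"
proof -
  have new: "{h. 1 < h \<and> h \<le> (2::nat) \<and> (\<exists>z\<in>set p. h \<le> z)} = (if 2 \<in> set p then {2} else {})"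
    using assms by (auto simp: le_Suc_eq numeral_2_eq_2)
  \<comment> \<open>The first column of \<open>2 # p\<close> is dry, so after the shift no cell lies in column 1.\<close>
  have dry: "(1, 2) \<notin> map_prod Suc id ` water_cells (2 # p)"
    by (auto simp: water_cells_def)
  have fin: "finite (map_prod Suc id ` water_cells (2 # p))"
    by (simp add: finite_water_cells)
  have "water_cells (2 # 1 # p) =
      map_prod Suc id ` water_cells (2 # p) \<union> {1} \<times> (if 2 \<in> set p then {2} else {})"
    using water_cells_drop_lower_second[of 1 2 p] unfolding new by simp
  then show ?thesis
    using dry fin card_shifted_water_cells[of "2 # p"] unfolding capacity_def[of "2 # 1 # p"]
    by (auto simp del: One_nat_def)
qed

lemma capacity_2_replicate_1: "capacity (2 # replicate n 1) = 0"
proof (induction n)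
  case (Suc n)
  have "set (replicate n 1) \<subseteq> {1, 2 :: nat}" "2 \<notin> set (replicate n (1 :: nat))" by auto
  then have "capacity (2 # 1 # replicate n 1) = capacity (2 # replicate n 1)"
    by (simp only: capacity_2_1) simp
  then show ?case using Suc by simp
qed (simp add: capacity_singleton)

section \<open>Splitting off the first part\<close>

lemma compositions12_iff: "p \<in> compositions12 n \<longleftrightarrow> set p \<subseteq> {1, 2} \<and> sum_list p = n"
  by (auto simp: compositions12_def compositions_def)

lemma compositions12_0: "compositions12 0 = {[]}"
proof -
  have "p = []" if "set p \<subseteq> {1, 2}" "sum_list p = 0" for p :: "nat list"
    using that by (cases p) auto
  then show ?thesis by (auto simp: compositions12_iff)
qed

lemma compositions12_1: "compositions12 1 = {[1]}"
proof -
  have "p = [1]" if "p \<in> compositions12 1" for p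
  proof (cases p)
    case (Cons x q)
    then have "x = 1" "q \<in> compositions12 0"
      using that by (auto simp: compositions12_iff)
    then show ?thesis using Cons by (simp add: compositions12_0)
  qed (use that in \<open>simp add: compositions12_iff\<close>)
  then show ?thesis by (auto simp: compositions12_iff)
qed

lemma sum_compositions12_Suc_Suc:
  fixes f :: "nat list \<Rightarrow> 'a::comm_monoid_add"
  shows "sum f (compositions12 (n + 2)) =
    (\<Sum>p\<in>compositions12 (n + 1). f (1 # p)) + (\<Sum>p\<in>compositions12 n. f (2 # p))"
proof -
  have "p \<in> (#) 1 ` compositions12 (n + 1) \<union> (#) 2 ` compositions12 n"
    if "p \<in> compositions12 (n + 2)" for p
    using that by (cases p) (auto simp: compositions12_iff)
  moreover have "(#) 1 ` compositions12 (n + 1) \<union> (#) 2 ` compositions12 n \<subseteq> compositions12 (n + 2)"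
    by (auto simp: compositions12_iff)
  ultimately have split:
    "compositions12 (n + 2) = (#) 1 ` compositions12 (n + 1) \<union> (#) 2 ` compositions12 n"
    by blast
  show ?thesis
    unfolding split
    by (subst sum.union_disjoint) (auto simp: finite_compositions12 sum.reindex)
qed

lemma compositions12_no_2_iff:
  assumes "p \<in> compositions12 n"
  shows "2 \<notin> set p \<longleftrightarrow> p = replicate n 1"
proof
  assume "2 \<notin> set p"
  then have "\<forall>x\<in>set p. x = 1" using assms by (auto simp: compositions12_iff)
  then have "replicate (length p) 1 = p" by (rule replicate_length_same)
  moreover from this have "sum_list p = length p"
    using sum_list_replicate[of "length p" "1::nat"] by simp
  ultimately show "p = replicate n 1" using assms by (simp add: compositions12_iff)
qed auto

section \<open>Recurrences for the weight sums\<close>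

definition b_behind_2 :: "nat \<Rightarrow> int poly" where
  "b_behind_2 n = (\<Sum>p\<in>compositions12 n. y ^ capacity (2 # p))"

lemma b_0: "b 0 = 1"
  and b_1: "b 1 = 1"
  and b_behind_2_0: "b_behind_2 0 = 1"
  and b_behind_2_1: "b_behind_2 1 = 1"
  using capacity_2_replicate_1[of 1]
  unfolding b_def b_behind_2_def compositions12_0 compositions12_1
  by (simp_all add: capacity_Nil capacity_singleton)

lemma b_rec: "b (n + 2) = b (n + 1) + b_behind_2 n"
proof -
  have "(\<Sum>p\<in>compositions12 (n + 1). y ^ capacity (1 # p)) = b (n + 1)"
    unfolding b_def by (rule sum.cong) (simp_all only: compositions12_iff capacity_1_Cons)
  then show ?thesis
    unfolding b_def[of "n + 2"] b_behind_2_def sum_compositions12_Suc_Suc by (simp only:)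
qed

text \<open>
  A \<open>1\<close> behind the wall contributes a factor \<open>y\<close> to every composition of the rest except to
  \<open>1 \<dots> 1\<close>, whose weight stays \<open>1\<close>; this is the source of the constant term.
\<close>

lemma b_behind_2_rec:
  "b_behind_2 (n + 2) = y * b_behind_2 (n + 1) + b_behind_2 n + (1 - y)"
proof -
  let ?ones = "replicate (n + 1) (1::nat)"
  have "y ^ capacity (2 # 1 # p) = y * y ^ capacity (2 # p) + (if p = ?ones then 1 - y else 0)"
    if "p \<in> compositions12 (n + 1)" for p
  proof (cases "p = ?ones")
    case True
    then show ?thesis
      using capacity_2_replicate_1[of "n + 1"] capacity_2_replicate_1[of "n + 2"] by simp
  next
    case False
    then have "2 \<in> set p" using compositions12_no_2_iff[OF that] by blast
    moreover have "set p \<subseteq> {1, 2}" using that by (simp add: compositions12_iff)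
    ultimately have "capacity (2 # 1 # p) = Suc (capacity (2 # p))"
      by (simp only: capacity_2_1) simp
    then show ?thesis using False by (simp only: power_Suc) simp
  qed
  then have "(\<Sum>p\<in>compositions12 (n + 1). y ^ capacity (2 # 1 # p)) =
      (\<Sum>p\<in>compositions12 (n + 1). y * y ^ capacity (2 # p) + (if p = ?ones then 1 - y else 0))"
    by (rule sum.cong[OF refl])
  also have "\<dots> = y * b_behind_2 (n + 1) + (1 - y)"
  proof -
    have "?ones \<in> compositions12 (n + 1)"
      by (auto simp: compositions12_iff sum_list_replicate)
    then show ?thesis
      unfolding b_behind_2_def sum.distrib sum_distrib_left
      by (simp only: sum.delta finite_compositions12 if_True)
  qed
  finally show ?thesis
    unfolding b_behind_2_def sum_compositions12_Suc_Suc capacity_2_2 by (simp only: ac_simps)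
qed

lemma b_2: "b 2 = 2"
proof -
  have "b 2 = b 1 + b_behind_2 0"
    using b_rec[of 0] by (simp only: add_0)
  then show ?thesis by (simp only: b_1 b_behind_2_0 one_add_one)
qed

lemma b_3: "b 3 = 3"
proof -
  have "1 + 2 = (3::nat)" "1 + 1 = (2::nat)" by simp_all
  then have "b 3 = b 2 + b_behind_2 1"
    using b_rec[of 1] by (simp only:)
  then show ?thesis unfolding b_2 b_behind_2_1 by simp
qed

text \<open>
  The two eliminations hold in an arbitrary commutative ring. Stating them with a variable
  in place of \<open>y\<close> keeps the simplifier from computing with the coefficients of the polynomial \<open>y\<close>.
\<close>

lemma eliminate_b_behind_2:
  fixes t :: "'a::comm_ring_1"
  assumes "b4 = b3 + c2" "b3 = b2 + c1" "b2 = b1 + c0" "c2 = t * c1 + c0 + (1 - t)"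
  shows "b4 = (1 + t) * b3 + (1 - t) * b2 - b1 + 1 - t"
proof -
  have "c1 = b3 - b2" "c0 = b2 - b1" using assms(2,3) by simp_all
  then have "b4 = b3 + (t * (b3 - b2) + (b2 - b1) + (1 - t))"
    using assms(1,4) by (simp only:)
  then show ?thesis by (simp add: algebra_simps)
qed

lemma eliminate_constant_term:
  fixes t :: "'a::comm_ring_1"
  assumes "b4 = (1 + t) * b3 + (1 - t) * b2 - b1 + 1 - t"
    and "b3 = (1 + t) * b2 + (1 - t) * b1 - b0 + 1 - t"
  shows "b4 = (2 + t) * b3 - 2 * t * b2 - (2 - t) * b1 + b0"
proof -
  have "b4 - b3 = ((1 + t) * b3 + (1 - t) * b2 - b1 + 1 - t) -
      ((1 + t) * b2 + (1 - t) * b1 - b0 + 1 - t)"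
    using assms by (rule arg_cong2[where f = minus])
  then show ?thesis by (simp add: algebra_simps)
qed

lemma b_recurrence_inhomogeneous:
  "b (n + 3) = (1 + y) * b (n + 2) + (1 - y) * b (n + 1) - b n + 1 - y"
proof (cases n)
  case 0
  show ?thesis
    unfolding 0 add_0 b_0 b_1 b_2 b_3 by (simp add: one_pCons numeral_poly)
next
  case (Suc m)
  have "b (m + 4) = b (m + 3) + b_behind_2 (m + 2)" "b (m + 3) = b (m + 2) + b_behind_2 (m + 1)"
    "b (m + 2) = b (m + 1) + b_behind_2 m"
    using b_rec[of "m + 2"] b_rec[of "m + 1"] b_rec[of m]
    by (simp_all only: add.assoc one_plus_numeral numeral_plus_one numeral_plus_numeral
        add_num_simps one_add_one)
  then have "b (m + 4) = (1 + y) * b (m + 3) + (1 - y) * b (m + 2) - b (m + 1) + 1 - y"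
    by (rule eliminate_b_behind_2) (rule b_behind_2_rec)
  moreover have "Suc m + 3 = m + 4" "Suc m + 2 = m + 3" "Suc m + 1 = m + 2" "Suc m = m + 1"
    by simp_all
  ultimately show ?thesis unfolding Suc by (simp only:)
qed

lemma b_recurrence_homogeneous:
  "b (n + 4) = (2 + y) * b (n + 3) - 2 * y * b (n + 2) - (2 - y) * b (n + 1) + b n"
proof -
  have "b (n + 4) = (1 + y) * b (n + 3) + (1 - y) * b (n + 2) - b (n + 1) + 1 - y"
  proof -
    have "n + 1 + 3 = n + 4" "n + 1 + 2 = n + 3" "n + 1 + 1 = n + 2" by simp_all
    then show ?thesis using b_recurrence_inhomogeneous[of "n + 1"] by (simp only:)
  qed
  then show ?thesis using b_recurrence_inhomogeneous[of n] by (rule eliminate_constant_term)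
qed

theorem theorem5:
  "(\<forall>n\<ge>3. b n = (1 + y) * b (n - 1) + (1 - y) * b (n - 2) - b (n - 3) + 1 - y) \<and>
   (\<forall>n\<ge>4. b n = (2 + y) * b (n - 1) - 2 * y * b (n - 2) - (2 - y) * b (n - 3) + b (n - 4)) \<and>
   b 0 = 1 \<and> b 1 = 1 \<and> b 2 = 2 \<and> b 3 = 3"
proof (intro conjI allI impI)
  fix n :: nat assume "3 \<le> n"
  then obtain k where n: "n = k + 3" using le_Suc_ex by (metis add.commute)
  have "n - 1 = k + 2" "n - 2 = k + 1" "n - 3 = k" using n by auto
  then show "b n = (1 + y) * b (n - 1) + (1 - y) * b (n - 2) - b (n - 3) + 1 - y"
    using b_recurrence_inhomogeneous[of k] n by (simp only:)
next
  fix n :: nat assume "4 \<le> n"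
  then obtain k where n: "n = k + 4" using le_Suc_ex by (metis add.commute)
  have "n - 1 = k + 3" "n - 2 = k + 2" "n - 3 = k + 1" "n - 4 = k" using n by auto
  then show "b n = (2 + y) * b (n - 1) - 2 * y * b (n - 2) - (2 - y) * b (n - 3) + b (n - 4)"
    using b_recurrence_homogeneous[of k] n by (simp only:)
qed (fact b_0 b_1 b_2 b_3)+

end
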